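(* For an infinite hallway $H$ (with initial doorway $D_0=(0,1)$), $\Phi(H)$ is a Sturmian sequence if and only if $H$ admits an infinite line of sight $\ell_{\alpha\beta}^\epsilon$ with $\alpha\in[0,1]$.
   Context: Let $\mathbb{R}^\epsilon=\{a+b\epsilon:a,b\in\mathbb{R}\}$ be the two-dimensional real vector space with basis $\{1,\epsilon\}$, totally ordered by $a+b\epsilon<c+d\epsilon$ iff $a<c$, or $a=c$ and $b<d$; intervals in $\mathbb{R}^\epsilon$ are taken with respect to this order. An infinite hallway is a set $H=\bigcup_{i\ge 0}\{i\}\times(\mathbb{R}^\epsilon\setminus D_i)\subset\mathbb{R}\times\mathbb{R}^\epsilon$, where $D_i=(d_i,d_i+1)\subset\mathbb{R}^\epsilon$ with $d_i\in\mathbb{Z}$ for $i\ge 0$ (the $i$th doorway); it is assumed that $D_0=(0,1)$. For $\alpha,\beta\in\mathbb{R}$ let $\ell^\epsilon_{\alpha\beta}=\{(x,\alpha x+\beta+t\epsilon):x,t\in\mathbb{R}\}$, and for $(x,y)\in\mathbb{R}\times\mathbb{R}^\epsilon$ let $\mathrm{proj}_\alpha(x,y)=y-\alpha x$. Define $\ell^\epsilon_{\alpha\beta}\vee H=\{a\in\mathbb{R}: a+b\epsilon\in \mathrm{proj}_\alpha(\ell^\epsilon_{\alpha\beta})\cap(\mathbb{R}^\epsilon\setminus\mathrm{proj}_\alpha(H))\text{ for some }b\in\mathbb{R}\}$; $\ell^\epsilon_{\alpha\beta}$ is an (infinite) line of sight for $H$ if $\ell^\epsilon_{\alpha\beta}\vee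 H\neq\emptyset$. $\Phi(H)\in\mathbb{Z}^{\mathbb{N}}$ is the sequence whose $i$th coordinate ($i\ge0$) is $d_{i+1}-d_i$. For $x\in\{0,1\}^{\mathbb{N}}$ let $L_n(x)$ be the number of distinct subwords (blocks of consecutive letters) of $x$ of length $n$. The sequence $x$ is periodic if there is $m>0$ with $(x)_i=(x)_{i+m}$ for all $i$. A sequence $x\in\{0,1\}^{\mathbb{N}}$ is a Sturmian sequence if it is periodic and satisfies $L_n(x)\le n+1$ for all $n$, or if it satisfies $L_n(x)=n+1$ for all $n$. (A known equivalent description: $x\in\{0,1\}^{\mathbb{N}}$ is Sturmian iff for some $(\alpha,\beta)\in[0,1]\times\mathbb{R}$ either $(x)_i=\lfloor(i+1)\alpha+\beta\rfloor-\lfloor i\alpha+\beta\rfloor$ for all $i\ge0$ or $(x)_i=\lceil(i+1)\alpha+\beta\rceil-\lceil i\alpha+\beta\rceil$ for all $i\ge 0$.) *)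

theory Defs
  imports Complex_Main
begin

text \<open>The ordered real vector space of all \<open>a + b \<epsilon>\<close>; \<open>Reps a b\<close> stands for
  \<open>a + b \<epsilon>\<close>. A separate type is used instead of \<open>real \<times> real\<close> because the lexicographic
  order on products cannot be loaded together with the componentwise one of
  the library theory \<open>Product_Order\<close>.\<close>

datatype reps = Reps (std_part: real) (eps_part: real)

instantiation reps :: real_vector
begin

definition "0 = Reps 0 0"
definition "x + y = Reps (std_part x + std_part y) (eps_part x + eps_part y)"
definition "- x = Reps (- std_part x) (- eps_part x)"
definition "x - y = Reps (std_part x - std_part y) (eps_part x - eps_part y)"
definition "scaleR r x = Reps (r * std_part x) (r * eps_part x)"

instance
  by standard
    (auto simp: zero_reps_def plus_reps_def uminus_reps_def minus_reps_def scaleR_reps_def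
      algebra_simps)

end

instantiation reps :: linorder
begin

definition "x < y \<longleftrightarrow>
  std_part x < std_part y \<or> std_part x = std_part y \<and> eps_part x < eps_part y"
definition "x \<le> y \<longleftrightarrow> x < y \<or> x = (y :: reps)"

instance
  by standard (auto simp: less_reps_def less_eq_reps_def reps.expand linorder_not_less le_less)

end

definition eps :: reps ("\<epsilon>")
  where "\<epsilon> = Reps 0 1"

definition of_std :: "real \<Rightarrow> reps"
  where "of_std a = Reps a 0"

lemma reps_basis: "Reps a b = of_std a + b *\<^sub>R \<epsilon>"
  by (simp add: of_std_def eps_def plus_reps_def scaleR_reps_def)

text \<open>A family of doorways is given by the sequence \<open>d\<close> of their left end points. The
  interval \<open>{of_std d <..< of_std (d + 1)}\<close> is taken in the lexicographic order, so it contains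
  \<open>of_std d + b *\<^sub>R \<epsilon>\<close> for \<open>b > 0\<close> and \<open>of_std (d + 1) + b *\<^sub>R \<epsilon>\<close> for \<open>b < 0\<close>.\<close>

definition doorway :: "int \<Rightarrow> reps set"
  where "doorway k = {of_std (of_int k) <..< of_std (of_int k + 1)}"

definition hallway :: "(nat \<Rightarrow> int) \<Rightarrow> (real \<times> reps) set"
  where "hallway d = (\<Union>i. {real i} \<times> (UNIV - doorway (d i)))"

definition infinite_hallway :: "(real \<times> reps) set \<Rightarrow> bool"
  where "infinite_hallway H \<longleftrightarrow> (\<exists>d. d 0 = 0 \<and> H = hallway d)"

text \<open>A hallway determines its doorways (lemma \<open>doorways_hallway\<close> below).\<close>

definition doorways :: "(real \<times> reps) set \<Rightarrow> nat \<Rightarrow> int"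
  where "doorways H = (THE d. H = hallway d)"

definition Phi :: "(real \<times> reps) set \<Rightarrow> nat \<Rightarrow> int"
  where "Phi H i = doorways H (Suc i) - doorways H i"

lemma hallway_inject: "hallway d = hallway d' \<longleftrightarrow> d = d'"
proof
  assume eq: "hallway d = hallway d'"
  show "d = d'"
  proof
    fix i
    have fiber: "y \<in> doorway (e i) \<longleftrightarrow> (real i, y) \<notin> hallway e" for y and e :: "nat \<Rightarrow> int"
      by (auto simp: hallway_def)
    have "of_std (of_int (d i) + 1/2) \<in> doorway (d i)"
      by (simp add: doorway_def less_reps_def of_std_def)
    then have "of_std (of_int (d i) + 1/2) \<in> doorway (d' i)"
      using fiber[of _ d] fiber[of _ d'] eq by simp
    then have "of_int (d' i) \<le> of_int (d i) + (1/2 :: real)"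
      and "of_int (d i) + (1/2 :: real) \<le> of_int (d' i) + 1"
      by (auto simp: doorway_def less_reps_def of_std_def)
    then show "d i = d' i" by linarith
  qed
qed simp

lemma doorways_hallway: "doorways (hallway d) = d"
  by (simp add: doorways_def hallway_inject)

definition eps_line :: "real \<Rightarrow> real \<Rightarrow> (real \<times> reps) set"
  where "eps_line \<alpha> \<beta> = {(x, of_std (\<alpha> * x + \<beta>) + t *\<^sub>R \<epsilon>) | x t. True}"

definition proj :: "real \<Rightarrow> real \<times> reps \<Rightarrow> reps"
  where "proj \<alpha> p = snd p - of_std (\<alpha> * fst p)"

definition sight :: "real \<Rightarrow> real \<Rightarrow> (real \<times> reps) set \<Rightarrow> real set"
  where "sight \<alpha> \<beta> H =
    {a. \<exists>b. of_std a + b *\<^sub>R \<epsilon> \<in> proj \<alpha> ` eps_line \<alpha> \<beta> \<inter> (UNIV - proj \<alpha> ` H)}"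

definition line_of_sight :: "real \<Rightarrow> real \<Rightarrow> (real \<times> reps) set \<Rightarrow> bool"
  where "line_of_sight \<alpha> \<beta> H \<longleftrightarrow> sight \<alpha> \<beta> H \<noteq> {}"

definition subwords :: "nat \<Rightarrow> (nat \<Rightarrow> 'a) \<Rightarrow> 'a list set"
  where "subwords n x = range (\<lambda>i. map x [i..<i + n])"

definition complexity :: "nat \<Rightarrow> (nat \<Rightarrow> 'a) \<Rightarrow> nat"
  where "complexity n x = card (subwords n x)"

definition periodic :: "(nat \<Rightarrow> 'a) \<Rightarrow> bool"
  where "periodic x \<longleftrightarrow> (\<exists>m>0. \<forall>i. x i = x (i + m))"

definition sturmian :: "(nat \<Rightarrow> int) \<Rightarrow> bool"
  where "sturmian x \<longleftrightarrow> range x \<subseteq> {0, 1} \<and>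
    (periodic x \<and> (\<forall>n. complexity n x \<le> n + 1) \<or> (\<forall>n. complexity n x = n + 1))"

end

theory Submission
  imports Defs
begin

text \<open>A line with slope \<open>\<alpha>\<close>, height \<open>\<beta>\<close> and infinitesimal offset \<open>b \<epsilon>\<close> passes
  through all doorways exactly if, depending on the sign of \<open>b\<close>, either
  \<open>d i = \<lfloor>\<alpha> i + \<beta>\<rfloor>\<close> for all \<open>i\<close> or \<open>d i = \<lceil>\<alpha> i + \<beta>\<rceil> - 1\<close> for all \<open>i\<close>: the infinitesimal
  decides consistently what happens when the line meets integer points. So the theorem is the
  theorem of Morse, Hedlund and Coven that Sturmian sequences are the step sequences of such
  digitized lines with slope in \<open>[0, 1]\<close>. The link between complexity and lines is
  balance: increments of \<open>d\<close> over equally long intervals differ by at most 1.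

  A digitized line is balanced because its increments over length \<open>n\<close> are within distance
  less than 1 of \<open>n \<alpha>\<close>. In a balanced sequence the vectors of increments that describe the
  subwords of length \<open>n\<close> form a chain, which leaves room for at most \<open>n + 1\<close> subwords
  (\<open>balanced_complexity\<close>). There are at least as many unless the sequence is
  eventually periodic (\<open>aperiodic_complexity\<close>), and for a digitized line eventual periodicity
  forces a rational slope and therefore periodicity (\<open>mechanical_eventually_periodic\<close>).

  Conversely, if a sequence of complexity at most \<open>n + 1\<close> is unbalanced, a shortest violation has the
  form \<open>0w0\<close>, \<open>1w1\<close> with a palindrome \<open>w\<close> (\<open>unbalanced_palindrome\<close>). Low complexity allows
  at most one right special subword of each length, so at most one of \<open>0w\<close> and \<open>1w\<close> is right
  special. Starting at an occurrence of \<open>bwb\<close> where \<open>bw\<close> is not right special, the other word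
  \<open>aw\<close> is avoided long enough for some window to repeat. From then on the sequence is
  deterministic and never meets \<open>aw\<close> again, which is impossible for a sequence that is periodic
  or not eventually periodic (\<open>low_complexity_balanced\<close>). A balanced sequence has a slope
  \<open>\<alpha>\<close> from which increments deviate by at most 1; with \<open>\<beta>\<close> the supremum of
  \<open>d i - \<alpha> i\<close> the line passes through all closed doorways. It could fail to be a line of sight
  only by touching a lower and an upper end point, and this happens only for sequences that are
  eventually periodic but not periodic (\<open>full_jump_not_recurrent\<close>).\<close>

section \<open>Windows and right special words\<close>

definition window :: "(nat \<Rightarrow> 'a) \<Rightarrow> nat \<Rightarrow> nat \<Rightarrow> 'a list"
  where "window x n i = map x [i..<i + n]"

text \<open>Over the alphabet \<open>{0, 1}\<close> this says that both \<open>v0\<close> and \<open>v1\<close> occur; two occurrences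
  with different successors express the notion over any alphabet.\<close>

definition right_special :: "(nat \<Rightarrow> 'a) \<Rightarrow> nat \<Rightarrow> 'a list \<Rightarrow> bool"
  where "right_special x n v \<longleftrightarrow>
    (\<exists>i j. window x n i = v \<and> window x n j = v \<and> x (i + n) \<noteq> x (j + n))"

definition eventually_periodic :: "(nat \<Rightarrow> 'a) \<Rightarrow> bool"
  where "eventually_periodic x \<longleftrightarrow> (\<exists>N. \<exists>P>0. \<forall>k\<ge>N. x k = x (k + P))"

lemma subwords_eq_range_window: "subwords n x = range (window x n)"
  by (simp add: subwords_def window_def)

lemma window_eq_iff: "window x n i = window x n j \<longleftrightarrow> (\<forall>k<n. x (i + k) = x (j + k))"
  by (simp add: window_def list_eq_iff_nth_eq)

lemma window_Suc: "window x (Suc n) i = window x n i @ [x (i + n)]"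
  by (simp add: window_def)

lemma window_Cons: "window x (Suc n) i = x i # window x n (Suc i)"
  by (simp add: window_def upt_conv_Cons del: upt_Suc)

lemma finite_subwords:
  assumes "finite (range x)"
  shows "finite (subwords n x)"
proof (rule finite_subset)
  show "subwords n x \<subseteq> {xs. set xs \<subseteq> range x \<and> length xs = n}"
    by (auto simp: subwords_def)
qed (rule finite_lists_length_eq[OF assms])

lemma complexity_0: "complexity 0 x = 1"
  by (simp add: complexity_def subwords_def)

text \<open>Every word of length \<open>n\<close> is the prefix of one of length \<open>n + 1\<close>, and a right special word
  is a prefix of at least two. Deleting one extension of each right special word therefore still
  leaves an extension of every word.\<close>

lemma complexity_right_special:
  assumes "finite (range x)"
  shows "finite {v. right_special x n v}"
    and "complexity n x + card {v. right_special x n v} \<le> complexity (Suc n) x"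
proof -
  let ?R = "{v. right_special x n v}"
  have fin: "finite (subwords k x)" for k
    by (rule finite_subwords[OF assms])
  have "?R \<subseteq> subwords n x"
    by (auto simp: right_special_def subwords_eq_range_window)
  then show finR: "finite ?R"
    using fin finite_subset by blast
  \<comment> \<open>\<open>g v\<close> is the extension of \<open>v\<close> to delete; the second occurrence keeps another one.\<close>
  have "\<forall>v\<in>?R. \<exists>p. window x n (fst p) = v \<and> window x n (snd p) = v
      \<and> x (fst p + n) \<noteq> x (snd p + n)"
    by (auto simp: right_special_def)
  then obtain p where p: "\<And>v. v \<in> ?R \<Longrightarrow> window x n (fst (p v)) = v \<and> window x n (snd (p v)) = v
      \<and> x (fst (p v) + n) \<noteq> x (snd (p v) + n)"
    by metis
  define g where "g v = window x (Suc n) (fst (p v))" for v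
  have butlast_g: "butlast (g v) = v" if "v \<in> ?R" for v
    using p[OF that] by (simp add: g_def window_Suc)
  have card_g: "card (g ` ?R) = card ?R"
    using butlast_g by (metis (no_types, lifting) card_image inj_on_inverseI)
  have g_sub: "g ` ?R \<subseteq> subwords (Suc n) x"
    by (auto simp: g_def subwords_eq_range_window)
  have "subwords n x \<subseteq> butlast ` (subwords (Suc n) x - g ` ?R)"
  proof
    fix v assume "v \<in> subwords n x"
    then obtain k where k: "v = window x n k"
      by (auto simp: subwords_eq_range_window)
    have "\<exists>l. window x n l = v \<and> window x (Suc n) l \<notin> g ` ?R"
    proof (cases "v \<in> ?R")
      case True
      have "window x (Suc n) (snd (p v)) \<notin> g ` ?R"
      proof
        assume "window x (Suc n) (snd (p v)) \<in> g ` ?R"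
        then obtain u where u: "u \<in> ?R" "window x (Suc n) (snd (p v)) = g u" by blast
        then have "u = v"
          using butlast_g[OF u(1)] p[OF True] by (simp add: window_Suc flip: u(2))
        then show False
          using u p[OF True] by (simp add: g_def window_Suc)
      qed
      then show ?thesis
        using p[OF True] by blast
    next
      case False
      then have "window x (Suc n) k \<notin> g ` ?R"
        using butlast_g k by (auto simp: window_Suc) (metis butlast_snoc mem_Collect_eq)
      then show ?thesis using k by blast
    qed
    then obtain l where l: "window x n l = v" "window x (Suc n) l \<notin> g ` ?R" by blast
    then show "v \<in> butlast ` (subwords (Suc n) x - g ` ?R)"
      by (intro image_eqI[of _ _ "window x (Suc n) l"])
        (auto simp: subwords_eq_range_window window_Suc)
  qed
  then have "card (subwords n x) \<le> card (subwords (Suc n) x - g ` ?R)"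
    by (meson fin finite_Diff surj_card_le)
  also have "\<dots> = card (subwords (Suc n) x) - card ?R"
    using card_g g_sub finR by (simp add: card_Diff_subset)
  moreover have "card ?R \<le> card (subwords (Suc n) x)"
    using card_mono[OF fin g_sub] card_g by simp
  ultimately show "complexity n x + card ?R \<le> complexity (Suc n) x"
    by (simp add: complexity_def)
qed

lemma right_special_tl:
  assumes "right_special x (Suc n) v"
  shows "right_special x n (tl v)"
proof -
  obtain i j where "window x (Suc n) i = v" "window x (Suc n) j = v" "x (i + Suc n) \<noteq> x (j + Suc n)"
    using assms by (auto simp: right_special_def)
  then have "window x n (Suc i) = tl v" "window x n (Suc j) = tl v" "x (Suc i + n) \<noteq> x (Suc j + n)"
    by (auto simp: window_Cons)
  then show ?thesis
    unfolding right_special_def by blast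
qed

lemma right_special_downward:
  assumes "right_special x n v" "k \<le> n"
  shows "\<exists>u. right_special x k u"
  using assms(2,1)
  by (induction arbitrary: v rule: dec_induct) (auto dest: right_special_tl)

text \<open>The complexity starts at 1 and grows at each length that has a right special word.\<close>

lemma complexity_lower_bound:
  assumes "finite (range x)" and "\<And>k. k < n \<Longrightarrow> \<exists>u. right_special x k u"
  shows "n + 1 \<le> complexity n x"
  using assms(2)
proof (induction n)
  case (Suc n)
  have "card {v. right_special x n v} > 0"
    using Suc.prems[of n] complexity_right_special(1)[OF assms(1)] by (auto simp: card_gt_0_iff)
  then show ?case
    using Suc complexity_right_special(2)[OF assms(1), of n] by fastforce
qed (simp add: complexity_0)

text \<open>Two right special words of length \<open>n\<close> would add 2 to the complexity at length \<open>n\<close>.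
  Their suffixes are right special too, so the complexity at length \<open>n\<close> has already reached
  \<open>n + 1\<close>, and the bound breaks at length \<open>n + 1\<close>.\<close>

lemma right_special_unique:
  assumes "finite (range x)" "\<And>n. complexity n x \<le> n + 1"
    and "right_special x n u" "right_special x n v"
  shows "u = v"
proof (rule ccontr)
  assume "u \<noteq> v"
  then have "2 = card {u, v}" by simp
  also have "\<dots> \<le> card {v. right_special x n v}"
    using assms by (intro card_mono complexity_right_special) auto
  finally have "complexity n x + 2 \<le> complexity (Suc n) x"
    using complexity_right_special(2)[OF assms(1), of n] by linarith
  moreover have "n + 1 \<le> complexity n x"
    using right_special_downward[OF assms(3)]
    by (intro complexity_lower_bound assms(1)) auto
  ultimately show False
    using assms(2)[of "Suc n"] by linarith
qed

text \<open>A window that is not right special determines its successor. Hence a window that comes back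
  without a right special one in between starts a cycle that is never left.\<close>

lemma return_without_right_special:
  assumes "i < j" "window x n i = window x n j"
    and "\<And>k. i \<le> k \<Longrightarrow> k < j \<Longrightarrow> \<not> right_special x n (window x n k)"
  shows "eventually_periodic x"
    and "i \<le> k \<Longrightarrow> window x n k \<in> window x n ` {i..<j}"
proof -
  have not_special: "\<not> right_special x n u" if "u \<in> window x n ` {i..<j}" for u
    using that assms(3) by auto
  define P where "P = j - i"
  have P: "P > 0" "j = i + P"
    using assms(1) by (auto simp: P_def)
  have *: "window x n k \<in> window x n ` {i..<j} \<and> window x n k = window x n (k + P)" if "i \<le> k" for k
    using that
  proof (induction k rule: less_induct)
    case (less k)
    have "window x n k \<in> window x n ` {i..<j}"
    proof (cases "k < j")
      case False
      then have "k - P < k" "i \<le> k - P" "k - P + P = k"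
        using P by auto
      then show ?thesis
        using less.IH[of "k - P"] by metis
    qed (use less in auto)
    moreover have "window x n k = window x n (k + P)"
    proof (cases "k = i")
      case False
      then obtain l where l: "k = Suc l" "i \<le> l"
        using less.prems by (metis Suc_leI Suc_le_D le_neq_implies_less not_less_eq_eq)
      with less.IH[of l] have IH: "window x n l \<in> window x n ` {i..<j}"
          "window x n l = window x n (l + P)" by (metis lessI)+
      then have "\<not> right_special x n (window x n l)"
        by (intro not_special)
      with IH(2) have "x (l + n) = x (l + P + n)"
        unfolding right_special_def by metis
      with IH(2) have "window x (Suc n) l = window x (Suc n) (l + P)"
        by (simp add: window_Suc)
      then show ?thesis
        by (simp add: window_Cons l)
    qed (use assms P in simp)
    ultimately show ?case by blast
  qed
  then show "i \<le> k \<Longrightarrow> window x n k \<in> window x n ` {i..<j}" by blast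
  have "x k = x (k + P)" if "i + n \<le> k" for k
  proof -
    define l where "l = k - n"
    then have l: "k = l + n" "i \<le> l" using that by auto
    have "\<not> right_special x n (window x n l)"
      using *[OF l(2)] by (intro not_special) blast
    with *[OF l(2)] have "x (l + n) = x (l + P + n)"
      unfolding right_special_def by metis
    then show ?thesis by (simp add: l ac_simps)
  qed
  then show "eventually_periodic x"
    unfolding eventually_periodic_def using P(1) by blast
qed

text \<open>The theorem of Morse and Hedlund: if no word of length \<open>k\<close> is right special, then any
  repeated window of length \<open>k\<close>, which exists by finiteness, closes a cycle.\<close>

lemma aperiodic_complexity:
  assumes "finite (range x)" "\<not> eventually_periodic x"
  shows "n + 1 \<le> complexity n x"
proof (rule complexity_lower_bound[OF assms(1)])
  fix k
  have "\<not> inj (window x k)"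
    using finite_subwords[OF assms(1), of k] finite_imageD
    unfolding subwords_eq_range_window by blast
  then obtain i j where "i < j" "window x k i = window x k j"
    unfolding inj_def by (metis linorder_neqE_nat)
  then show "\<exists>u. right_special x k u"
    using return_without_right_special(1) assms(2) by metis
qed

text \<open>Every tail already occurs as a tail that starts before the end of the first period.\<close>

lemma eventually_periodic_reduce:
  fixes N :: nat
  assumes "\<forall>k\<ge>N. x k = x (k + P)" "P > 0"
  shows "\<exists>l<N + P. \<forall>k. x (i + k) = x (l + k)"
proof (induction i rule: less_induct)
  case (less i)
  show ?case
  proof (cases "i < N + P")
    case False
    then have "i - P < i"
      using assms(2) by simp
    then obtain l where l: "l < N + P" "\<forall>k. x (i - P + k) = x (l + k)"
      using less.IH by blast
    have "x (i + k) = x (i - P + k)" for k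
    proof -
      have "N \<le> i - P + k" "i - P + k + P = i + k"
        using False by auto
      then show ?thesis
        using assms(1) by metis
    qed
    then show ?thesis
      using l by metis
  qed blast
qed

lemma eventually_periodic_bounded_complexity:
  assumes "eventually_periodic x"
  shows "\<exists>B. \<forall>n. complexity n x \<le> B"
proof -
  obtain N P where NP: "\<forall>k\<ge>N. x k = x (k + P)" "P > 0"
    using assms by (auto simp: eventually_periodic_def)
  have "complexity n x \<le> N + P" for n
  proof -
    have "subwords n x \<subseteq> window x n ` {..<N + P}"
    proof
      fix v assume "v \<in> subwords n x"
      then obtain i where i: "v = window x n i"
        by (auto simp: subwords_eq_range_window)
      obtain l where "l < N + P" "\<forall>k. x (i + k) = x (l + k)"
        using eventually_periodic_reduce[OF NP] by blast
      then show "v \<in> window x n ` {..<N + P}"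
        by (intro image_eqI[of _ _ l]) (auto simp: i window_eq_iff)
    qed
    then have "complexity n x \<le> card (window x n ` {..<N + P})"
      unfolding complexity_def by (intro card_mono) auto
    also have "\<dots> \<le> N + P"
      using card_image_le[of "{..<N + P}" "window x n"] by simp
    finally show ?thesis .
  qed
  then show ?thesis by blast
qed

lemma periodic_shift:
  fixes m :: nat
  assumes "\<forall>i. x i = x (i + m)"
  shows "x (i + t * m) = x i"
proof (induction t)
  case (Suc t)
  have "i + Suc t * m = i + t * m + m"
    by simp
  then show ?case
    using Suc assms by metis
qed simp

section \<open>Balanced sequences\<close>

definition steps :: "(nat \<Rightarrow> int) \<Rightarrow> nat \<Rightarrow> int"
  where "steps d i = d (Suc i) - d i"

definition balanced :: "(nat \<Rightarrow> int) \<Rightarrow> bool"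
  where "balanced d \<longleftrightarrow> (\<forall>i j n. d (i + n) - d i \<le> d (j + n) - d j + 1)"

text \<open>A subword of length \<open>n\<close> is determined by the vector of increments
  \<open>d (i + k) - d i\<close> for \<open>k \<le> n\<close>. Two such vectors are comparable componentwise: a
  larger entry at one index and a smaller one at another would give a difference of 2 between these
  indices. So the vector is determined by the sum of its entries, and by balance these sums lie in an interval
  of \<open>n + 1\<close> integers.\<close>

lemma balanced_complexity:
  assumes "balanced d"
  shows "complexity n (steps d) \<le> n + 1"
proof -
  have bal: "d (i + k) - d i \<le> d (j + k) - d j + 1" for i j k
    using assms by (simp add: balanced_def)
  define s where "s i = (\<Sum>k\<le>n. d (i + k) - d i)" for i
  have comparable: "(\<forall>k\<le>n. d (i + k) - d i \<le> d (j + k) - d j)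
      \<or> (\<forall>k\<le>n. d (j + k) - d j \<le> d (i + k) - d i)" for i j
  proof (rule ccontr)
    assume "\<not> ?thesis"
    then obtain k l where kl: "d (i + k) - d i > d (j + k) - d j" "d (j + l) - d j > d (i + l) - d i"
      by (meson not_le)
    show False
    proof (cases "k \<le> l")
      case True
      then show False
        using bal[of "j + k" "l - k" "i + k"] kl by simp
    next
      case False
      then show False
        using bal[of "i + l" "k - l" "j + l"] kl by simp
    qed
  qed
  have eqI: "window (steps d) n i = window (steps d) n j"
    if le: "\<forall>k\<le>n. d (i + k) - d i \<le> d (j + k) - d j" and eq: "s i = s j" for i j
  proof -
    have "d (i + k) - d i = d (j + k) - d j" if "k \<le> n" for k
    proof (rule ccontr)
      assume "d (i + k) - d i \<noteq> d (j + k) - d j"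
      then have "s i < s j"
        unfolding s_def using le that by (intro sum_strict_mono_ex1) (auto simp: order_less_le)
      then show False using eq by simp
    qed
    then have "d (i + Suc k) - d i = d (j + Suc k) - d j" "d (i + k) - d i = d (j + k) - d j"
      if "k < n" for k
      using that by (simp_all add: Suc_leI less_imp_le del: add_Suc_right)
    then show ?thesis
      unfolding window_eq_iff steps_def by (smt (verit) add_Suc_right)
  qed
  have "window (steps d) n i = window (steps d) n j" if "s i = s j" for i j
    using comparable[of i j] eqI[of i j] eqI[of j i] that by auto
  then have "window (steps d) n i = window (steps d) n (inv s (s i))" for i
    by (metis f_inv_into_f rangeI)
  then have sub: "subwords n (steps d) \<subseteq> (\<lambda>v. window (steps d) n (inv s v)) ` range s"
    unfolding subwords_eq_range_window by blast
  have close: "s i \<le> s j + int n" for i j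
  proof -
    have "s i = (\<Sum>k<n. d (i + Suc k) - d i)" for i
      unfolding s_def by (simp only: lessThan_Suc_atMost[symmetric] sum.lessThan_Suc_shift) simp
    moreover have "(\<Sum>k<n. d (i + Suc k) - d i) \<le> (\<Sum>k<n. d (j + Suc k) - d j + 1)"
      by (intro sum_mono bal)
    ultimately show ?thesis by (simp add: sum.distrib)
  qed
  have fin: "finite (range s)"
    by (rule finite_subset[of _ "{s 0 - int n..s 0 + int n}"]) (use close in \<open>auto, smt (verit)\<close>)
  obtain j where j: "Min (range s) = s j"
    using Min_in[OF fin] by auto
  have "range s \<subseteq> {s j..s j + int n}"
    using close Min_le[OF fin] unfolding j by auto
  then have "card (range s) \<le> card {s j..s j + int n}"
    by (intro card_mono) auto
  also have "\<dots> = n + 1" by simp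
  finally have "card (range s) \<le> n + 1" .
  moreover have "complexity n (steps d) \<le> card (range s)"
    unfolding complexity_def
    by (rule order.trans[OF card_mono[OF _ sub] card_image_le]) (use fin in auto)
  ultimately show ?thesis by linarith
qed

text \<open>Take a shortest pair of intervals whose increments differ by 2. Minimality forces the
  difference to be 1 at all intermediate points, so the two words are \<open>1w1\<close> and \<open>0w0\<close> with the
  same \<open>w\<close>. If \<open>w\<close> were no palindrome, let \<open>p\<close> be the longest prefix whose reversal
  is a suffix; then the letter after \<open>p\<close> and the letter before the reversal of \<open>p\<close> differ. As \<open>p\<close> and its
  reversal have the same sum, a prefix of one word and a suffix of the other, namely \<open>0p0\<close>
  and the reversal of \<open>1p1\<close> or the other way round, form a shorter such pair.\<close>

lemma unbalanced_palindrome: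
  assumes bin: "\<And>i. steps d i \<in> {0, 1}" and "\<not> balanced d"
  obtains i j m where
    "steps d i = 1" "steps d (i + Suc m) = 1" "steps d j = 0" "steps d (j + Suc m) = 0"
    "\<And>k. k < m \<Longrightarrow> steps d (i + Suc k) = steps d (j + Suc k)"
    "\<And>k. k < m \<Longrightarrow> steps d (i + Suc k) = steps d (i + (m - k))"
proof -
  define Q where "Q n \<longleftrightarrow> (\<exists>i j. d (i + n) - d i \<ge> d (j + n) - d j + 2)" for n
  define n where "n = (LEAST n. Q n)"
  have "\<exists>n. Q n"
    using assms(2) unfolding balanced_def Q_def by (smt (verit))
  then have "Q n"
    unfolding n_def by (rule LeastI_ex)
  then obtain i j where ij: "d (i + n) - d i \<ge> d (j + n) - d j + 2"
    unfolding Q_def by blast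
  have small: "d (a + k) - d a \<le> d (b + k) - d b + 1" if "k < n" for a b k
  proof -
    have "\<not> Q k"
      using not_less_Least that unfolding n_def by blast
    then have "\<not> d (b + k) - d b + 2 \<le> d (a + k) - d a"
      unfolding Q_def by blast
    then show ?thesis by linarith
  qed
  have mid: "d (i + k) - d i = d (j + k) - d j + 1" if "0 < k" "k < n" for k
    using small[of k i j] small[of "n - k" "i + k" "j + k"] ij that by simp
  have step01: "steps d k = 0 \<or> steps d k = 1" for k
    using bin by auto
  have "n \<noteq> 0"
    using ij by (intro notI) simp
  moreover have "n \<noteq> 1"
    using ij step01[of i] step01[of j] by (intro notI) (auto simp: steps_def)
  ultimately have "n = (n - 2) + 2" by simp
  then obtain m where n: "n = m + 2" by blast
  have first: "steps d i = 1" "steps d j = 0"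
    using mid[of 1] step01[of i] step01[of j] n by (auto simp: steps_def)
  have last: "steps d (i + Suc m) = 1" "steps d (j + Suc m) = 0"
    using mid[of "Suc m"] ij step01[of "i + Suc m"] step01[of "j + Suc m"] n by (auto simp: steps_def)
  have same: "steps d (i + Suc k) = steps d (j + Suc k)" if "k < m" for k
    using mid[of "Suc k"] mid[of "Suc (Suc k)"] n that by (simp add: steps_def)
  have pal: "steps d (i + Suc k) = steps d (i + (m - k))" if "k < m" for k
    using that
  proof (induction k rule: less_induct)
    case (less l)
    have sum_eq: "d (i + Suc k) - d (i + 1) = d (i + Suc m) - d (i + Suc m - k)" if "k \<le> l" for k
      using that
    proof (induction k)
      case (Suc k)
      have idx: "i + Suc m - k = Suc (i + (m - k))" "i + Suc m - Suc k = i + (m - k)"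
        using Suc.prems less.prems by auto
      have "steps d (i + Suc k) = steps d (i + (m - k))"
        using less.IH[of k] Suc.prems less.prems by simp
      moreover have "d (i + Suc k) - d (i + 1) = d (i + Suc m) - d (i + Suc m - k)"
        using Suc by simp
      ultimately show ?case
        unfolding idx steps_def by simp
    qed simp
    have eqs: "i + Suc m - l = Suc (i + (m - l))" "j + Suc m - l = Suc (j + (m - l))"
      "i + (m - l) + (l + 2) = Suc (i + Suc m)" "j + (m - l) + (l + 2) = Suc (j + Suc m)"
      "i + (l + 2) = Suc (i + Suc l)" "j + (l + 2) = Suc (j + Suc l)"
      "i + 1 = Suc i"
      using less.prems by auto
    have same': "steps d (i + (m - l)) = steps d (j + (m - l))"
      using same[of "m - l - 1"] less.prems by (simp add: Suc_diff_Suc)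
    have m1: "d (j + Suc l) = d (i + Suc l) - d i + d j - 1"
      using mid[of "Suc l"] less.prems n by simp
    have m2: "d (j + Suc m) = d (i + Suc m) - d i + d j - 1"
      using mid[of "Suc m"] n by simp
    have m3: "d (j + Suc m - l) = d (i + Suc m - l) - d i + d j - 1"
      using mid[of "Suc (m - l)"] n less.prems unfolding eqs by simp
    have b1: "d (i + (l + 2)) - d i \<le> d (j + (m - l) + (l + 2)) - d (j + (m - l)) + 1"
      and b2: "d (i + (m - l) + (l + 2)) - d (i + (m - l)) \<le> d (j + (l + 2)) - d j + 1"
      using less.prems n by (intro small; simp)+
    note facts = sum_eq[of l, OF order.refl] m1 m2 m3 same' same[OF less.prems] first last
    show ?case
    proof (rule ccontr)
      assume "steps d (i + Suc l) \<noteq> steps d (i + (m - l))"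
      then consider "steps d (i + Suc l) = 1" "steps d (i + (m - l)) = 0"
        | "steps d (i + Suc l) = 0" "steps d (i + (m - l)) = 1"
        using step01[of "i + Suc l"] step01[of "i + (m - l)"] by argo
      then show False
      proof cases
        case 1
        then show False
          using b1 facts unfolding eqs steps_def by linarith
      next
        case 2
        then show False
          using b2 facts unfolding eqs steps_def by linarith
      qed
    qed
  qed
  show thesis
    by (rule that[OF first(1) last(1) first(2) last(2) same pal])
qed

text \<open>The last hypothesis excludes skew sequences such as \<open>0011111...\<close>: it is what makes the word
  that is avoided by a cycle come back.\<close>

lemma low_complexity_balanced:
  assumes bin: "\<And>i. steps d i \<in> {0, 1}"
    and cplx: "\<And>n. complexity n (steps d) \<le> n + 1"
    and per: "eventually_periodic (steps d) \<Longrightarrow> periodic (steps d)"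
  shows "balanced d"
proof (rule ccontr)
  define x where "x = steps d"
  have step01: "x k = 0 \<or> x k = 1" for k
    using bin by (auto simp: x_def)
  have "range x \<subseteq> {0, 1}"
    using bin by (auto simp: x_def)
  then have fin: "finite (range x)"
    using finite_subset by blast
  have unique: "u = v" if "right_special x n u" "right_special x n v" for n u v
    using right_special_unique[OF fin _ that] cplx by (simp add: x_def)
  \<comment> \<open>The word at \<open>r\<close> is \<open>bwb\<close>, the word at \<open>s\<close> starts with \<open>aw\<close>, the only candidate for a right special word.\<close>
  have no_pair: False
    if ends: "x r = x (r + Suc m)" "x s \<noteq> x r"
      and same: "\<And>k. k < m \<Longrightarrow> x (s + Suc k) = x (r + Suc k)"
      and pal: "\<And>k. k < m \<Longrightarrow> x (r + Suc k) = x (r + (m - k))"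
      and special: "\<And>v. right_special x (Suc m) v \<Longrightarrow> v = window x (Suc m) s"
    for r s m
  proof -
    let ?w = "window x (Suc m)"
    \<comment> \<open>If \<open>aw\<close> occurred in \<open>bwb...\<close> at offset \<open>t\<close>, the final \<open>b\<close> of \<open>bwb\<close> would be the letter of \<open>w\<close>
      that mirrors the letter \<open>a\<close> at offset \<open>t\<close>.\<close>
    have avoid: "?w (r + t) \<noteq> ?w s" if "t \<le> Suc m" for t
    proof
      assume "?w (r + t) = ?w s"
      then have eq: "x (r + t + k) = x (s + k)" if "k \<le> m" for k
        using that by (simp add: window_eq_iff)
      have t: "t \<noteq> 0" "t \<noteq> Suc m"
        using eq[of 0] ends by (auto intro: ccontr)
      then have t: "0 < t" "t \<le> m" using that by auto
      have "x (r + Suc m) = x (s + Suc (m - t))"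
        using eq[of "Suc (m - t)"] t by simp
      also have "\<dots> = x (r + Suc (m - t))"
        using same[of "m - t"] t by simp
      also have "\<dots> = x (r + t)"
        using pal[of "t - 1"] t by (simp add: Suc_diff_le)
      also have "\<dots> = x s"
        using eq[of 0] by simp
      finally show False using ends by simp
    qed
    have fin_w: "finite (subwords (Suc m) x)"
      by (rule finite_subwords[OF fin])
    \<comment> \<open>There are \<open>m + 2\<close> windows for at most \<open>m + 1\<close> words other than \<open>aw\<close>.\<close>
    have "card ((\<lambda>t. ?w (r + t)) ` {..Suc m}) \<le> card (subwords (Suc m) x - {?w s})"
      using fin_w avoid by (intro card_mono) (auto simp: subwords_eq_range_window)
    also have "\<dots> < card {..Suc m}"
      using cplx[of "Suc m"] fin_w
      by (simp add: complexity_def x_def[symmetric] card_Diff_singleton subwords_eq_range_window)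
    finally have "\<not> inj_on (\<lambda>t. ?w (r + t)) {..Suc m}"
      by (metis card_image less_irrefl)
    then obtain t t' where t: "t < t'" "t' \<le> Suc m" "?w (r + t) = ?w (r + t')"
      unfolding inj_on_def by (metis atMost_iff linorder_neqE_nat)
    have non_special: "?w k \<noteq> ?w s" if "r + t \<le> k" "k < r + t'" for k
      using avoid[of "k - r"] that t by simp
    have ret: "r + t < r + t'" "?w (r + t) = ?w (r + t')"
      "\<And>k. r + t \<le> k \<Longrightarrow> k < r + t' \<Longrightarrow> \<not> right_special x (Suc m) (?w k)"
      using t non_special special by auto
    have "periodic x"
      using return_without_right_special(1)[OF ret] per by (simp add: x_def)
    then obtain q where q: "q > 0" "\<forall>i. x i = x (i + q)"
      by (auto simp: periodic_def)
    \<comment> \<open>By periodicity \<open>aw\<close> comes back after the cycle has been entered.\<close>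
    define k where "k = s + (r + t) * q"
    have "?w k = ?w s"
      unfolding window_eq_iff k_def using periodic_shift[OF q(2)]
      by (metis add.assoc add.commute)
    moreover have "r + t \<le> k"
      using q(1) by (simp add: k_def trans_le_add2)
    ultimately have "?w s \<in> ?w ` {r + t..<r + t'}"
      using return_without_right_special(2)[OF ret] by metis
    then show False
      using non_special by force
  qed
  assume "\<not> balanced d"
  then obtain i j m where ij: "x i = 1" "x (i + Suc m) = 1" "x j = 0" "x (j + Suc m) = 0"
    and same: "\<And>k. k < m \<Longrightarrow> x (i + Suc k) = x (j + Suc k)"
    and pal: "\<And>k. k < m \<Longrightarrow> x (i + Suc k) = x (i + (m - k))"
    using unbalanced_palindrome[OF bin] unfolding x_def by metis
  have pal': "x (j + Suc k) = x (j + (m - k))" if "k < m" for k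
    using same[of k] pal[of k] same[of "m - Suc k"] that by (simp add: Suc_diff_Suc)
  have tails: "window x m (Suc i) = window x m (Suc j)"
    using same by (simp add: window_eq_iff)
  have "right_special x m (window x m (Suc i))"
    unfolding right_special_def using tails ij by (metis add_Suc add_Suc_right zero_neq_one)
  then have "tl v = window x m (Suc i)" if "right_special x (Suc m) v" for v
    using right_special_tl[OF that] unique by blast
  moreover have "v \<noteq> [] \<and> (hd v = 0 \<or> hd v = 1)" if "right_special x (Suc m) v" for v
    using that step01 unfolding right_special_def window_Cons by fastforce
  ultimately have cand: "v = window x (Suc m) i \<or> v = window x (Suc m) j"
    if "right_special x (Suc m) v" for v
    using that ij tails by (metis list.collapse window_Cons)
  \<comment> \<open>Both candidates have the tail \<open>w\<close>, the right special word of length \<open>m\<close>; the one that may be right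
    special has to be avoided.\<close>
  show False
  proof (cases "right_special x (Suc m) (window x (Suc m) i)")
    case True
    show False
      by (rule no_pair[of j m i]) (use ij same pal' unique[OF _ True] in auto)
  next
    case False
    show False
      by (rule no_pair[of i m j]) (use ij same pal cand False in auto)
  qed
qed

section \<open>Balanced sequences and lines\<close>

lemma balanced_multiple_bounds:
  assumes "balanced d"
  shows "int k * (d (i + n) - d i - 1) \<le> d (k * n) - d 0"
    and "d (k * n) - d 0 \<le> int k * (d (i + n) - d i + 1)"
proof -
  have bal: "d (i + n) - d i \<le> d (j + n) - d j + 1" for i j n
    using assms by (simp add: balanced_def)
  show "int k * (d (i + n) - d i - 1) \<le> d (k * n) - d 0"
  proof (induction k)
    case (Suc k)
    then show ?case
      using bal[of i n "k * n"] by (simp add: algebra_simps)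
  qed simp
  show "d (k * n) - d 0 \<le> int k * (d (i + n) - d i + 1)"
  proof (induction k)
    case (Suc k)
    then show ?case
      using bal[of "k * n" n i] by (simp add: algebra_simps)
  qed simp
qed

text \<open>Cutting an interval of length \<open>k n\<close> into pieces of length \<open>n\<close> and into pieces of length
  \<open>k\<close> shows that each lower estimate \<open>(d (i + n) - d i - 1) / n\<close> of the slope is below each
  upper estimate \<open>(d (j + k) - d j + 1) / k\<close>. Any number in between works.\<close>

lemma balanced_slope:
  assumes "balanced d"
  obtains \<alpha> :: real where "\<And>i n. \<bar>of_int (d (i + n) - d i) - real n * \<alpha>\<bar> \<le> 1"
proof -
  define S where "S = {of_int (d (i + n) - d i - 1) / real n | i n. n > 0}"
  define \<alpha> where "\<alpha> = Sup S"
  have bound: "of_int (d (i + n) - d i - 1) / real n \<le> of_int (d (j + k) - d j + 1) / real k"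
    if "n > 0" "k > 0" for i j n k
  proof -
    have "int k * (d (i + n) - d i - 1) \<le> d (k * n) - d 0"
      by (rule balanced_multiple_bounds[OF assms])
    also have "\<dots> = d (n * k) - d 0"
      by (simp add: mult.commute)
    also have "\<dots> \<le> int n * (d (j + k) - d j + 1)"
      by (rule balanced_multiple_bounds[OF assms])
    finally have "real_of_int (int k * (d (i + n) - d i - 1)) \<le> of_int (int n * (d (j + k) - d j + 1))"
      by (rule of_int_le_iff[THEN iffD2])
    then show ?thesis
      using that by (simp add: field_simps)
  qed
  have ne: "S \<noteq> {}"
    by (auto simp: S_def)
  have "\<bar>of_int (d (i + n) - d i) - real n * \<alpha>\<bar> \<le> 1" for i n
  proof (cases "n = 0")
    case False
    then have n: "n > 0" by simp
    have bdd: "bdd_above S"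
      unfolding S_def using bound[OF _ n, where j = i]
      by (intro bdd_aboveI[of _ "of_int (d (i + n) - d i + 1) / real n"]) auto
    have "of_int (d (i + n) - d i - 1) / real n \<le> \<alpha>"
      unfolding \<alpha>_def by (rule cSup_upper[OF _ bdd]) (use n in \<open>auto simp: S_def\<close>)
    moreover have "\<alpha> \<le> of_int (d (i + n) - d i + 1) / real n"
      unfolding \<alpha>_def using bound[OF _ n] by (intro cSup_least[OF ne]) (auto simp: S_def)
    ultimately show ?thesis
      using n by (simp add: field_simps abs_le_iff)
  qed simp
  then show thesis by (rule that)
qed

text \<open>If an increment of length \<open>n\<close> exceeds \<open>n \<alpha>\<close> by the maximal amount 1, then by balance no
  increment of length \<open>n\<close> is below \<open>n \<alpha>\<close>, which is an integer. So along each residue class modulo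
  \<open>n\<close> the deviation from the line never decreases, and being bounded it can jump only once.
  After these finitely many jumps the sequence has period \<open>n\<close>. A periodic sequence would
  repeat the jump.\<close>

lemma full_jump_not_recurrent:
  assumes bal: "balanced d"
    and slope: "\<And>i n. \<bar>of_int (d (i + n) - d i) - real n * \<alpha>\<bar> \<le> 1"
    and jump: "of_int (d (i + n) - d i) = real n * \<alpha> + 1"
  shows "eventually_periodic (steps d)" "\<not> periodic (steps d)"
proof -
  have n: "n > 0"
    using jump by (cases n) auto
  define c where "c = d (i + n) - d i - 1"
  have c: "real n * \<alpha> = of_int c"
    using jump by (simp add: c_def)
  define f where "f s = d (s + n) - d s - c" for s
  have f_ge: "f s \<ge> 0" for s
    using bal[unfolded balanced_def, rule_format, of i n s] by (simp add: f_def c_def)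
  have along: "d (s + t * n) - d s \<ge> int t * c" for s t
  proof (induction t)
    case (Suc t)
    then show ?case
      using f_ge[of "s + t * n"] by (simp add: f_def algebra_simps)
  qed simp
  have once: "f s' = 0" if "f s \<noteq> 0" "s' = s + Suc t * n" for s s' t
  proof (rule ccontr)
    assume "f s' \<noteq> 0"
    then have "f s \<ge> 1" "f s' \<ge> 1"
      using f_ge[of s] f_ge[of s'] that(1) by auto
    moreover have "d (s + n + t * n) - d (s + n) \<ge> int t * c"
      by (rule along)
    moreover have "s' = s + n + t * n" using that(2) by simp
    ultimately have "d (s + (t + 2) * n) - d s \<ge> int (t + 2) * c + 2"
      by (simp add: f_def algebra_simps)
    then have "real_of_int (d (s + (t + 2) * n) - d s) \<ge> of_int (int (t + 2) * c + 2)"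
      by (rule of_int_le_iff[THEN iffD2])
    also have "of_int (int (t + 2) * c + 2) = real ((t + 2) * n) * \<alpha> + 2"
      by (simp add: c[symmetric] algebra_simps)
    finally show False
      using slope[of s "(t + 2) * n"] by linarith
  qed
  have "inj_on (\<lambda>s. s mod n) {s. f s \<noteq> 0}"
  proof (rule linorder_inj_onI)
    fix s s' assume s: "s < s'" "s \<in> {s. f s \<noteq> 0}" "s' \<in> {s. f s \<noteq> 0}"
    show "s mod n \<noteq> s' mod n"
    proof
      assume "s mod n = s' mod n"
      then have "n dvd s' - s"
        using s(1) by (metis less_imp_le mod_eq_dvd_iff_nat)
      then obtain t where t: "s' - s = n * t" by blast
      with s(1) have "t \<noteq> 0" by (cases t) auto
      then obtain u where "t = Suc u" by (cases t) auto
      then have "s' = s + Suc u * n" using t s(1) by (simp add: algebra_simps)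
      then show False using once s by blast
    qed
  qed auto
  moreover have "finite ((\<lambda>s. s mod n) ` {s. f s \<noteq> 0})"
    by (rule finite_subset[of _ "{..<n}"]) (use n in auto)
  ultimately have "finite {s. f s \<noteq> 0}"
    by (rule finite_imageD[rotated])
  then obtain N where N: "\<And>s. s \<ge> N \<Longrightarrow> f s = 0"
    by (metis (mono_tags, lifting) finite_nat_set_iff_bounded mem_Collect_eq not_le)
  have "steps d k = steps d (k + n)" if "k \<ge> N" for k
    using N[of k] N[of "Suc k"] that by (simp add: f_def steps_def)
  then show "eventually_periodic (steps d)"
    unfolding eventually_periodic_def using n by blast
  show "\<not> periodic (steps d)"
  proof
    assume "periodic (steps d)"
    then obtain q where q: "q > 0" "\<forall>i. steps d i = steps d (i + q)"
      by (auto simp: periodic_def)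
    have shift: "steps d (s + N * q) = steps d s" for s
      by (rule periodic_shift[OF q(2)])
    have "d (i + N * q + t) - d (i + N * q) = d (i + t) - d i" for t
    proof (induction t)
      case (Suc t)
      then show ?case
        using shift[of "i + t"] by (simp add: steps_def ac_simps)
    qed simp
    from this[of n] have "f (i + N * q) = f i"
      by (simp add: f_def)
    moreover have "f (i + N * q) = 0"
      using q(1) by (intro N) (simp add: trans_le_add2)
    ultimately show False
      by (simp add: f_def c_def)
  qed
qed

text \<open>Mechanical words: \<open>d i\<close> is \<open>\<lfloor>\<alpha> i + \<beta>\<rfloor>\<close> in the first case and
  \<open>\<lceil>\<alpha> i + \<beta>\<rceil> - 1\<close> in the second. The case must be the same for all \<open>i\<close>.\<close>

definition mechanical :: "real \<Rightarrow> real \<Rightarrow> (nat \<Rightarrow> int) \<Rightarrow> bool"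
  where "mechanical \<alpha> \<beta> d \<longleftrightarrow>
    (\<forall>i. of_int (d i) \<le> \<alpha> * real i + \<beta> \<and> \<alpha> * real i + \<beta> < of_int (d i) + 1) \<or>
    (\<forall>i. of_int (d i) < \<alpha> * real i + \<beta> \<and> \<alpha> * real i + \<beta> \<le> of_int (d i) + 1)"

lemma balanced_imp_mechanical:
  assumes bal: "balanced d" and bin: "\<And>i. steps d i \<in> {0, 1}"
    and per: "eventually_periodic (steps d) \<Longrightarrow> periodic (steps d)"
  shows "\<exists>\<alpha> \<beta>. \<alpha> \<in> {0..1} \<and> mechanical \<alpha> \<beta> d"
proof -
  obtain \<alpha> :: real where slope: "\<And>i n. \<bar>of_int (d (i + n) - d i) - real n * \<alpha>\<bar> \<le> 1"
    using balanced_slope[OF bal] by blast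
  define e where "e i = of_int (d i) - \<alpha> * real i" for i
  have e_add: "e (i + n) - e i = of_int (d (i + n) - d i) - real n * \<alpha>" for i n
    by (simp add: e_def algebra_simps)
  have close: "e i \<le> e j + 1" for i j
    using slope[of i "j - i"] slope[of j "i - j"] e_add[of i "j - i"] e_add[of j "i - j"]
    by (cases "i \<le> j") auto
  \<comment> \<open>The line at height \<open>Sup e\<close> can touch both a lower and an upper doorway end only if two values of \<open>e\<close>
    differ by exactly 1; which one comes first is a matter of replacing \<open>d\<close> by \<open>- d\<close>.\<close>
  have no_rise: "e (i + n) \<noteq> e i + 1" for i n
  proof
    assume "e (i + n) = e i + 1"
    then have "of_int (d (i + n) - d i) = real n * \<alpha> + 1"
      using e_add[of i n] by simp
    then show False
      using full_jump_not_recurrent[OF bal slope] per by blast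
  qed
  have no_fall: "e (i + n) + 1 \<noteq> e i" for i n
  proof
    assume "e (i + n) + 1 = e i"
    then have fall: "of_int (- d (i + n) - - d i) = real n * - \<alpha> + 1"
      using e_add[of i n] by simp
    have bal': "balanced (\<lambda>i. - d i)"
      using bal unfolding balanced_def by (smt (verit))
    have slope': "\<bar>of_int (- d (i + n) - - d i) - real n * - \<alpha>\<bar> \<le> 1" for i n
      using slope[of i n] by (simp add: abs_le_iff)
    have steps_neg: "steps (\<lambda>i. - d i) = (\<lambda>i. - steps d i)"
      by (auto simp: steps_def)
    have "eventually_periodic (steps (\<lambda>i. - d i)) = eventually_periodic (steps d)"
      "periodic (steps (\<lambda>i. - d i)) = periodic (steps d)"
      by (simp_all add: eventually_periodic_def periodic_def steps_neg)
    then show False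
      using full_jump_not_recurrent[OF bal' slope' fall] per by simp
  qed
  have no_gap: "e j \<noteq> e i + 1" for i j
    using no_rise[of i "j - i"] no_fall[of j "i - j"] by (cases "i \<le> j") auto
  define \<beta> where "\<beta> = (SUP i. e i)"
  have bdd: "bdd_above (range e)"
    using close[of _ 0] by (intro bdd_aboveI[of _ "e 0 + 1"]) auto
  have \<beta>: "e i \<le> \<beta>" "\<beta> \<le> e i + 1" for i
    unfolding \<beta>_def using close[of _ i] by (auto intro!: cSUP_upper bdd cSUP_least)
  have "mechanical \<alpha> \<beta> d"
  proof (cases "\<exists>i. \<beta> = e i + 1")
    case True
    then have "e j \<noteq> \<beta>" for j
      using no_gap by metis
    then show ?thesis
      unfolding mechanical_def using \<beta> by (auto simp: e_def less_le algebra_simps)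
  next
    case False
    then show ?thesis
      unfolding mechanical_def using \<beta> by (auto simp: e_def less_le algebra_simps)
  qed
  moreover have "\<alpha> \<in> {0..1}"
  proof -
    have range: "0 \<le> d n - d 0 \<and> d n - d 0 \<le> int n" for n
    proof (induction n)
      case (Suc n)
      then show ?case using bin[of n] by (auto simp: steps_def)
    qed simp
    have "real n * - \<alpha> \<le> 1" "real n * (\<alpha> - 1) \<le> 1" for n
      using range[of n] slope[of 0 n] by (auto simp: algebra_simps abs_le_iff)
    then have "- \<alpha> \<le> 0" "\<alpha> - 1 \<le> 0"
      by (meson ex_less_of_nat_mult not_le)+
    then show ?thesis by simp
  qed
  ultimately show ?thesis by blast
qed

lemma mechanical_increment:
  assumes "mechanical \<alpha> \<beta> d"
  shows "\<bar>of_int (d (i + n) - d i) - real n * \<alpha>\<bar> < 1"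
  using assms unfolding mechanical_def
proof (elim disjE)
  assume "\<forall>i. of_int (d i) \<le> \<alpha> * real i + \<beta> \<and> \<alpha> * real i + \<beta> < of_int (d i) + 1"
  from this[rule_format, of i] this[rule_format, of "i + n"] show ?thesis
    by (simp add: abs_less_iff algebra_simps)
next
  assume "\<forall>i. of_int (d i) < \<alpha> * real i + \<beta> \<and> \<alpha> * real i + \<beta> \<le> of_int (d i) + 1"
  from this[rule_format, of i] this[rule_format, of "i + n"] show ?thesis
    by (simp add: abs_less_iff algebra_simps)
qed

lemma mechanical_balanced:
  assumes "mechanical \<alpha> \<beta> d"
  shows "balanced d"
  unfolding balanced_def
proof (intro allI)
  fix i j n
  show "d (i + n) - d i \<le> d (j + n) - d j + 1"
    using mechanical_increment[OF assms, of i n] mechanical_increment[OF assms, of j n] by linarith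
qed

lemma mechanical_binary:
  assumes "mechanical \<alpha> \<beta> d" "\<alpha> \<in> {0..1}"
  shows "steps d i \<in> {0, 1}"
proof -
  have "-1 < real_of_int (steps d i)" "real_of_int (steps d i) < 2"
    using mechanical_increment[OF assms(1), of i 1] assms(2) by (auto simp: steps_def)
  then have "-1 < steps d i" "steps d i < 2" by linarith+
  then show ?thesis by auto
qed

text \<open>An eventual period \<open>P\<close> with increment \<open>c\<close> forces \<open>P \<alpha> = c\<close>, since the deviation
  from the line is bounded. Then shifting by \<open>P\<close> raises the line by an integer everywhere.\<close>

lemma mechanical_eventually_periodic:
  assumes mech: "mechanical \<alpha> \<beta> d" and "eventually_periodic (steps d)"
  shows "periodic (steps d)"
proof -
  obtain N P where P: "P > 0" and N: "\<And>k. k \<ge> N \<Longrightarrow> steps d k = steps d (k + P)"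
    using assms(2) by (auto simp: eventually_periodic_def)
  define c where "c = d (N + P) - d N"
  have const: "d (k + P) - d k = c" if "k \<ge> N" for k
    using that
  proof (induction rule: dec_induct)
    case (step k)
    then show ?case using N[of k] by (simp add: steps_def)
  qed (simp add: c_def)
  have mult: "d (N + t * P) - d N = int t * c" for t
  proof (induction t)
    case (Suc t)
    then show ?case
      using const[of "N + t * P"] by (simp add: algebra_simps)
  qed simp
  have "\<bar>real t * (of_int c - real P * \<alpha>)\<bar> < 1" for t
    using mechanical_increment[OF mech, of N "t * P"] unfolding mult by (simp add: algebra_simps)
  then have "real t * \<bar>of_int c - real P * \<alpha>\<bar> < 1" for t
    by (simp add: abs_mult)
  then have "\<bar>of_int c - real P * \<alpha>\<bar> \<le> 0"
    by (meson ex_less_of_nat_mult not_le less_asym)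
  then have c: "real P * \<alpha> = of_int c" by simp
  \<comment> \<open>Both sides are integers at distance less than 1.\<close>
  have "d (k + P) - d k = c" for k
    using mechanical_increment[OF mech, of k P] unfolding c by linarith
  then have "d (k + P) = d k + c" for k
    by (metis add.commute diff_add_cancel)
  then have "steps d k = steps d (k + P)" for k
    unfolding steps_def by (metis add_Suc add_diff_cancel_right)
  then show ?thesis
    unfolding periodic_def using P by blast
qed

section \<open>Sturmian sequences and lines of sight\<close>

text \<open>Both alternatives in the definition of Sturmian sequences make an eventually periodic sequence
  periodic: the second one because unbounded complexity excludes eventual periodicity.\<close>

lemma sturmian_iff_mechanical:
  "sturmian (steps d) \<longleftrightarrow> (\<exists>\<alpha> \<beta>. \<alpha> \<in> {0..1} \<and> mechanical \<alpha> \<beta> d)"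
proof
  assume st: "sturmian (steps d)"
  then have bin: "steps d i \<in> {0, 1}" for i
    by (auto simp: sturmian_def)
  have cplx: "complexity n (steps d) \<le> n + 1" for n
    using st by (auto simp: sturmian_def)
  have per: "periodic (steps d)" if ep: "eventually_periodic (steps d)"
  proof -
    obtain B where "\<And>n. complexity n (steps d) \<le> B"
      using eventually_periodic_bounded_complexity[OF ep] by blast
    from this[of B] show ?thesis
      using st by (auto simp: sturmian_def)
  qed
  show "\<exists>\<alpha> \<beta>. \<alpha> \<in> {0..1} \<and> mechanical \<alpha> \<beta> d"
    using balanced_imp_mechanical low_complexity_balanced bin cplx per by blast
next
  assume "\<exists>\<alpha> \<beta>. \<alpha> \<in> {0..1} \<and> mechanical \<alpha> \<beta> d"
  then obtain \<alpha> \<beta> where \<alpha>: "\<alpha> \<in> {0..1}" and mech: "mechanical \<alpha> \<beta> d" by blast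
  have bin: "range (steps d) \<subseteq> {0, 1}"
    using mechanical_binary[OF mech \<alpha>] by blast
  then have fin: "finite (range (steps d))"
    using finite_subset by blast
  have upper: "complexity n (steps d) \<le> n + 1" for n
    by (rule balanced_complexity[OF mechanical_balanced[OF mech]])
  show "sturmian (steps d)"
  proof (cases "eventually_periodic (steps d)")
    case True
    then show ?thesis
      using mechanical_eventually_periodic[OF mech] bin upper by (simp add: sturmian_def)
  next
    case False
    then have "complexity n (steps d) = n + 1" for n
      using aperiodic_complexity[OF fin] upper by (metis order.antisym)
    then show ?thesis
      using bin by (simp add: sturmian_def)
  qed
qed

lemma mem_doorway:
  "Reps a b \<in> doorway k \<longleftrightarrow>
    (of_int k < a \<or> a = of_int k \<and> 0 < b) \<and> (a < of_int k + 1 \<or> a = of_int k + 1 \<and> b < 0)"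
  by (auto simp: doorway_def of_std_def less_reps_def)

lemma line_of_sight_iff_doorways:
  "line_of_sight \<alpha> \<beta> (hallway d) \<longleftrightarrow> (\<exists>b. \<forall>i. Reps (\<alpha> * real i + \<beta>) b \<in> doorway (d i))"
proof -
  have line: "Reps a b \<in> proj \<alpha> ` eps_line \<alpha> \<beta> \<longleftrightarrow> a = \<beta>" for a b
  proof -
    have "proj \<alpha> (x, of_std (\<alpha> * x + \<beta>) + t *\<^sub>R \<epsilon>) = Reps \<beta> t" for x t
      by (simp add: proj_def of_std_def eps_def plus_reps_def minus_reps_def scaleR_reps_def)
    then have "proj \<alpha> ` eps_line \<alpha> \<beta> = {Reps \<beta> t | t. True}"
      unfolding eps_line_def by (auto simp: image_iff) metis
    then show ?thesis by auto
  qed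
  have wall: "Reps a b \<in> proj \<alpha> ` hallway d \<longleftrightarrow> (\<exists>i. Reps (\<alpha> * real i + a) b \<notin> doorway (d i))"
    for a b
  proof
    assume "Reps a b \<in> proj \<alpha> ` hallway d"
    then obtain i y where "y \<notin> doorway (d i)" "Reps a b = y - of_std (\<alpha> * real i)"
      by (auto simp: hallway_def proj_def)
    then show "\<exists>i. Reps (\<alpha> * real i + a) b \<notin> doorway (d i)"
      by (intro exI[of _ i], cases y) (simp add: of_std_def minus_reps_def)
  next
    assume "\<exists>i. Reps (\<alpha> * real i + a) b \<notin> doorway (d i)"
    then obtain i where "Reps (\<alpha> * real i + a) b \<notin> doorway (d i)" by blast
    then have "(real i, Reps (\<alpha> * real i + a) b) \<in> hallway d"
      by (auto simp: hallway_def)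
    moreover have "Reps a b = proj \<alpha> (real i, Reps (\<alpha> * real i + a) b)"
      by (simp add: proj_def of_std_def minus_reps_def)
    ultimately show "Reps a b \<in> proj \<alpha> ` hallway d" by blast
  qed
  show ?thesis
    unfolding line_of_sight_def sight_def reps_basis[symmetric] by (auto simp: line wall)
qed

text \<open>Only the sign of the offset matters: a positive \<open>b\<close> lets the line touch the lower end points of
  doorways, a negative one the upper end points.\<close>

lemma line_of_sight_iff_mechanical:
  "line_of_sight \<alpha> \<beta> (hallway d) \<longleftrightarrow> mechanical \<alpha> \<beta> d"
proof
  assume "line_of_sight \<alpha> \<beta> (hallway d)"
  then obtain b where b: "\<forall>i. Reps (\<alpha> * real i + \<beta>) b \<in> doorway (d i)"
    unfolding line_of_sight_iff_doorways by (elim exE)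
  show "mechanical \<alpha> \<beta> d"
  proof (cases "b < 0")
    case True
    have "of_int (d i) < \<alpha> * real i + \<beta> \<and> \<alpha> * real i + \<beta> \<le> of_int (d i) + 1" for i
      using b[rule_format, of i] True unfolding mem_doorway by linarith
    then show ?thesis
      unfolding mechanical_def by (intro disjI2 allI)
  next
    case False
    have "of_int (d i) \<le> \<alpha> * real i + \<beta> \<and> \<alpha> * real i + \<beta> < of_int (d i) + 1" for i
      using b[rule_format, of i] False unfolding mem_doorway by linarith
    then show ?thesis
      unfolding mechanical_def by (intro disjI1 allI)
  qed
next
  assume "mechanical \<alpha> \<beta> d"
  then show "line_of_sight \<alpha> \<beta> (hallway d)"
    unfolding mechanical_def
  proof (elim disjE)
    assume line: "\<forall>i. of_int (d i) \<le> \<alpha> * real i + \<beta> \<and> \<alpha> * real i + \<beta> < of_int (d i) + 1"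
    have "Reps (\<alpha> * real i + \<beta>) 1 \<in> doorway (d i)" for i
      using line[rule_format, of i] unfolding mem_doorway by linarith
    then show ?thesis
      unfolding line_of_sight_iff_doorways by (intro exI allI)
  next
    assume line: "\<forall>i. of_int (d i) < \<alpha> * real i + \<beta> \<and> \<alpha> * real i + \<beta> \<le> of_int (d i) + 1"
    have "Reps (\<alpha> * real i + \<beta>) (- 1) \<in> doorway (d i)" for i
      using line[rule_format, of i] unfolding mem_doorway by linarith
    then show ?thesis
      unfolding line_of_sight_iff_doorways by (intro exI allI)
  qed
qed

theorem theorem53:
  fixes H :: "(real \<times> reps) set"
  assumes "infinite_hallway H"
  shows "sturmian (Phi H) \<longleftrightarrow> (\<exists>\<alpha> \<beta>. \<alpha> \<in> {0..1} \<and> line_of_sight \<alpha> \<beta> H)"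
proof -
  obtain d where H: "H = hallway d"
    using assms by (auto simp: infinite_hallway_def)
  have "Phi H = steps d"
    by (rule ext) (simp add: Phi_def steps_def H doorways_hallway)
  then show ?thesis
    by (simp add: sturmian_iff_mechanical H line_of_sight_iff_mechanical)
qed

end
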